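(* Let $E,\|\cdot\|,Q,d,V$, the operator $g:Q\to E^*$, the constants $L>0,\delta>0$ and the algorithm MPAI (Mirror Prox with Adaptation to Inexactness) be as described in the context. Let $x^k$ $(0\le k\le N)$ and $y^{k},L^{k},\delta^{k}$ $(1\le k\le N)$ be the points and parameters produced by $N\ge 1$ iterations of MPAI run with inputs $L^0>0$, $\delta^0>0$ and $x^0=\arg\min_{x\in Q}d(x)$. Then for every $x\in Q$ $$\sum_{k=0}^{N-1}\frac{1}{L^{k+1}}\langle g(y^{k+1}),\,y^{k+1}-x\rangle\le V(x,x^0)-V(x,x^N)+\sum_{k=0}^{N-1}\frac{\delta^{k+1}}{L^{k+1}}\,\|y^{k+1}-x^{k+1}\|.$$
   Context: Setting. $(E,\|\cdot\|)$ is a finite-dimensional real normed space, $E^*$ is its dual with norm $\|y\|_*=\max\{\langle y,x\rangle:\|x\|\le 1\}$, where $\langle y,x\rangle$ is the value of the linear functional $y$ at $x$. $Q\subset E$ is a nonempty closed convex set. $d:Q\to\mathbb{R}$ (the distance generating function) is continuously differentiable and $1$-strongly convex with respect to $\|\cdot\|$, and $\min_{x\in Q}d(x)=d(0)$. The Bregman divergence is $V(x,y)=d(x)-d(y)-\langle\nabla d(y),x-y\rangle$ for $x,y\in Q$. Operator. $g:Q\to E^*$ is a continuous operator such that, for fixed constants $L>0$ and $\delta>0$, $$\langle g(y)-g(x),\,y-z\rangle\le L\,V(y,x)+L\,V(z,y)+\delta\|y-z\|\qquad\forall\,x,y,z\in Q.$$ Algorithm MPAI. Input: $x^0=\arg\min_{x\in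 Q}d(x)$, $L^0>0$, $\delta^0>0$. Iteration $k$ $(k=0,1,2,\dots)$ computes $x^{k+1},y^{k+1},L^{k+1},\delta^{k+1}$ from $x^k,L^k,\delta^k$ as follows. 1. Set $L^{k+1}:=L^k/2$ and $\delta^{k+1}:=\delta^k/2$. 2. Compute $$y^{k+1}:=\arg\min_{x\in Q}\{\langle g(x^k),x-x^k\rangle+L^{k+1}V(x,x^k)\},$$ $$x^{k+1}:=\arg\min_{x\in Q}\{\langle g(y^{k+1}),x-x^k\rangle+L^{k+1}V(x,x^k)\}.$$ 3. If $$\langle g(y^{k+1})-g(x^k),\,y^{k+1}-x^{k+1}\rangle\le L^{k+1}V(y^{k+1},x^k)+L^{k+1}V(x^{k+1},y^{k+1})+\delta^{k+1}\|y^{k+1}-x^{k+1}\|,$$ accept the current $x^{k+1},y^{k+1},L^{k+1},\delta^{k+1}$ and go to the next iteration. 4. Otherwise multiply both $L^{k+1}$ and $\delta^{k+1}$ by $2$ and return to step 2. Throughout, $x^{k+1},y^{k+1},L^{k+1},\delta^{k+1}$ denote the accepted values. *)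

theory Defs
  imports "HOL-Analysis.Analysis"
begin

text \<open>
  The dual space is the type \<open>'a \<Rightarrow>\<^sub>L real\<close> of bounded linear functionals. Its norm is the
  operator norm, and for finite-dimensional \<open>'a\<close> it contains every linear functional.
  The space is not taken to be of class \<open>euclidean_space\<close>, since that would force the norm
  to come from an inner product.
\<close>

definition finite_dimensional_space :: "'a::real_vector itself \<Rightarrow> bool" where
  "finite_dimensional_space _ \<longleftrightarrow> (\<exists>B::'a set. finite B \<and> span B = UNIV)"

abbreviation pairing :: "('a::real_normed_vector \<Rightarrow>\<^sub>L real) \<Rightarrow> 'a \<Rightarrow> real" where
  "pairing \<equiv> blinfun_apply"

text \<open>
  The set \<open>Q\<close> may have empty interior, so the gradient is a map given along with \<open>d\<close>, which
  represents the derivative within \<open>Q\<close>. For convex \<open>Q\<close> the numbers \<open>pairing (G y) (x - y)\<close>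
  with \<open>x, y \<in> Q\<close>, the only values that enter the Bregman divergence, do not
  depend on the choice of \<open>G\<close>.
\<close>

definition continuous_gradient_on ::
  "'a::real_normed_vector set \<Rightarrow> ('a \<Rightarrow> real) \<Rightarrow> ('a \<Rightarrow> 'a \<Rightarrow>\<^sub>L real) \<Rightarrow> bool" where
  "continuous_gradient_on Q d G \<longleftrightarrow>
     (\<forall>x\<in>Q. (d has_derivative pairing (G x)) (at x within Q)) \<and> continuous_on Q G"

definition strongly_convex_on ::
  "real \<Rightarrow> 'a::real_normed_vector set \<Rightarrow> ('a \<Rightarrow> real) \<Rightarrow> bool" where
  "strongly_convex_on \<mu> Q d \<longleftrightarrow>
     convex Q \<and>
     (\<forall>x\<in>Q. \<forall>y\<in>Q. \<forall>t\<in>{0..1}.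
        d ((1 - t) *\<^sub>R x + t *\<^sub>R y)
          \<le> (1 - t) * d x + t * d y - \<mu> / 2 * t * (1 - t) * (norm (x - y))\<^sup>2)"

definition bregman ::
  "('a::real_normed_vector \<Rightarrow> real) \<Rightarrow> ('a \<Rightarrow> 'a \<Rightarrow>\<^sub>L real) \<Rightarrow> 'a \<Rightarrow> 'a \<Rightarrow> real" where
  "bregman d G x y = d x - d y - pairing (G y) (x - y)"

abbreviation argmin_on :: "('a \<Rightarrow> real) \<Rightarrow> 'a set \<Rightarrow> 'a \<Rightarrow> bool" where
  "argmin_on f Q x \<equiv> is_arg_min f (\<lambda>z. z \<in> Q) x"

definition mirror_step ::
  "'a::real_normed_vector set \<Rightarrow> ('a \<Rightarrow> real) \<Rightarrow> ('a \<Rightarrow> 'a \<Rightarrow>\<^sub>L real) \<Rightarrow>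
     ('a \<Rightarrow>\<^sub>L real) \<Rightarrow> real \<Rightarrow> 'a \<Rightarrow> 'a \<Rightarrow> bool" where
  "mirror_step Q d G p M u v \<longleftrightarrow>
     argmin_on (\<lambda>z. pairing p (z - u) + M * bregman d G z u) Q v"

definition accept_test ::
  "('a::real_normed_vector \<Rightarrow> real) \<Rightarrow> ('a \<Rightarrow> 'a \<Rightarrow>\<^sub>L real) \<Rightarrow> ('a \<Rightarrow> 'a \<Rightarrow>\<^sub>L real) \<Rightarrow>
     real \<Rightarrow> real \<Rightarrow> 'a \<Rightarrow> 'a \<Rightarrow> 'a \<Rightarrow> bool" where
  "accept_test d G g M e u v w \<longleftrightarrow>
     pairing (g v - g u) (v - w)
       \<le> M * bregman d G v u + M * bregman d G w v + e * norm (v - w)"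

text \<open>
  \<open>mpai_search Q d G g u M e w v M' e'\<close>: the inner loop at the current point \<open>u\<close>, entered with
  trial parameters \<open>M\<close> and \<open>e\<close>, accepts the next point \<open>w\<close>, the
  auxiliary point \<open>v\<close> and the parameters \<open>M'\<close> and \<open>e'\<close>.
\<close>

inductive mpai_search ::
  "'a::real_normed_vector set \<Rightarrow> ('a \<Rightarrow> real) \<Rightarrow> ('a \<Rightarrow> 'a \<Rightarrow>\<^sub>L real) \<Rightarrow> ('a \<Rightarrow> 'a \<Rightarrow>\<^sub>L real) \<Rightarrow>
     'a \<Rightarrow> real \<Rightarrow> real \<Rightarrow> 'a \<Rightarrow> 'a \<Rightarrow> real \<Rightarrow> real \<Rightarrow> bool"
  for Q d G g u where
  accept:
    "mpai_search Q d G g u M e w v M e"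
    if "mirror_step Q d G (g u) M u v"
       "mirror_step Q d G (g v) M u w"
       "accept_test d G g M e u v w"
| reject:
    "mpai_search Q d G g u M e w' v' M' e'"
    if "mirror_step Q d G (g u) M u v"
       "mirror_step Q d G (g v) M u w"
       "\<not> accept_test d G g M e u v w"
       "mpai_search Q d G g u (2 * M) (2 * e) w' v' M' e'"

text \<open>
  The values \<open>Ls 0\<close> and \<open>ds 0\<close> are the inputs of the algorithm; \<open>ys 0\<close> is not used.
\<close>

definition mpai_run ::
  "'a::real_normed_vector set \<Rightarrow> ('a \<Rightarrow> real) \<Rightarrow> ('a \<Rightarrow> 'a \<Rightarrow>\<^sub>L real) \<Rightarrow> ('a \<Rightarrow> 'a \<Rightarrow>\<^sub>L real) \<Rightarrow>
     nat \<Rightarrow> (nat \<Rightarrow> 'a) \<Rightarrow> (nat \<Rightarrow> 'a) \<Rightarrow> (nat \<Rightarrow> real) \<Rightarrow> (nat \<Rightarrow> real) \<Rightarrow> bool" where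
  "mpai_run Q d G g N xs ys Ls ds \<longleftrightarrow>
     argmin_on d Q (xs 0) \<and> Ls 0 > 0 \<and> ds 0 > 0 \<and>
     (\<forall>k<N. mpai_search Q d G g (xs k) (Ls k / 2) (ds k / 2)
              (xs (Suc k)) (ys (Suc k)) (Ls (Suc k)) (ds (Suc k)))"

end

theory Submission
  imports Defs
begin

text \<open>
  The first-order optimality condition of a prox step \<open>v\<close> from \<open>u\<close> along \<open>p\<close> and the three-point
  identity for \<open>V\<close> give \<open>\<langle>p, v - z\<rangle> \<le> M (V(z,u) - V(z,v) - V(v,u))\<close> for all \<open>z \<in> Q\<close>.
  Apply this to the second prox step of an iteration at \<open>z = x\<close> and to the first one
  at \<open>z = x\<^sup>k\<^sup>+\<^sup>1\<close>, and add the acceptance inequality: everything cancels except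
  \<open>L\<^sup>k\<^sup>+\<^sup>1 (V(x,x\<^sup>k) - V(x,x\<^sup>k\<^sup>+\<^sup>1))\<close> and the error term. Dividing by \<open>L\<^sup>k\<^sup>+\<^sup>1\<close> makes the sum over \<open>k\<close>
  telescope.
\<close>

text \<open>On the segment from \<open>v\<close> to \<open>z\<close>, a negative slope at
  \<open>v\<close> would make \<open>f\<close> drop below its minimum. Only the one-sided derivative
  along the segment enters, so \<open>S\<close> may have empty interior.\<close>

lemma argmin_on_derivative_nonneg:
  fixes f :: "'a::real_normed_vector \<Rightarrow> real"
  assumes min: "argmin_on f S v" and "convex S" and z: "z \<in> S"
    and deriv: "(f has_derivative f') (at v within S)"
  shows "0 \<le> f' (z - v)"
proof (rule ccontr)
  assume "\<not> 0 \<le> f' (z - v)"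
  define \<gamma> where "\<gamma> = (\<lambda>t::real. v + t *\<^sub>R (z - v))"
  have v: "v \<in> S" and le: "f v \<le> f y" if "y \<in> S" for y
    using min that by (auto simp: is_arg_min_linorder)
  have in_S: "\<gamma> t \<in> S" if "t \<in> {0..1}" for t
  proof -
    have "\<gamma> t = (1 - t) *\<^sub>R v + t *\<^sub>R z"
      by (simp add: \<gamma>_def algebra_simps)
    then show ?thesis
      using convexD_alt[OF \<open>convex S\<close> v[OF z] z, of t] that by simp
  qed
  have "(\<gamma> has_derivative (\<lambda>t. t *\<^sub>R (z - v))) (at 0 within {0..1})"
    unfolding \<gamma>_def by (auto intro!: derivative_eq_intros)
  moreover have "(f has_derivative f') (at (\<gamma> 0) within \<gamma> ` {0..1})"
    using deriv in_S by (auto simp: \<gamma>_def intro: has_derivative_subset)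
  ultimately have "((\<lambda>t. f (\<gamma> t)) has_derivative (\<lambda>t. f' (t *\<^sub>R (z - v)))) (at 0 within {0..1})"
    by (rule has_derivative_in_compose)
  \<comment> \<open>By linearity the derivative along the segment is multiplication by the slope
    \<open>f' (z - v)\<close>.\<close>
  moreover have "(\<lambda>t. f' (t *\<^sub>R (z - v))) = (*) (f' (z - v))"
    using linear_cmul[OF has_derivative_linear[OF deriv]] by (simp add: fun_eq_iff)
  ultimately have "((\<lambda>t. f (\<gamma> t)) has_real_derivative f' (z - v)) (at 0 within {0..1})"
    by (simp add: has_field_derivative_def)
  moreover have "f' (z - v) < 0"
    using \<open>\<not> 0 \<le> f' (z - v)\<close> by simp
  ultimately obtain e where e: "e > 0"
    "\<And>h. 0 < h \<Longrightarrow> 0 + h \<in> {0..1} \<Longrightarrow> h < e \<Longrightarrow> f (\<gamma> (0 + h)) < f (\<gamma> 0)"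
    by (meson has_real_derivative_neg_dec_right)
  \<comment> \<open>Small enough for the strict decrease, and at most 1 so that
    \<open>\<gamma> h\<close> stays in \<open>S\<close>.\<close>
  define h where "h = min 1 (e / 2)"
  have "0 < h" "h \<in> {0..1}" "h < e"
    using \<open>e > 0\<close> by (auto simp: h_def)
  then have "f (\<gamma> h) < f v"
    using e(2)[of h] by (simp add: \<gamma>_def)
  then show False
    using le[OF in_S[OF \<open>h \<in> {0..1}\<close>]] by simp
qed

lemma mirror_step_in: "mirror_step Q d G p M u v \<Longrightarrow> v \<in> Q"
  by (simp add: mirror_step_def is_arg_min_def)

lemma mirror_step_three_point:
  assumes grad: "continuous_gradient_on Q d G" and "convex Q"
    and step: "mirror_step Q d G p M u v" and "z \<in> Q"
  shows "pairing p (v - z) \<le> M * (bregman d G z u - bregman d G z v - bregman d G v u)"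
proof -
  have "(d has_derivative pairing (G v)) (at v within Q)"
    using grad mirror_step_in[OF step] by (simp add: continuous_gradient_on_def)
  then have "((\<lambda>z. pairing p (z - u) + M * bregman d G z u) has_derivative
      (\<lambda>w. pairing p w + M * (pairing (G v) w - pairing (G u) w))) (at v within Q)"
    unfolding bregman_def by (auto intro!: derivative_eq_intros)
  then have "0 \<le> pairing p (z - v) + M * (pairing (G v) (z - v) - pairing (G u) (z - v))"
    using argmin_on_derivative_nonneg step \<open>convex Q\<close> \<open>z \<in> Q\<close>
    unfolding mirror_step_def by blast
  \<comment> \<open>Three-point identity: all values of \<open>d\<close> cancel, and the
    \<open>G u\<close> terms combine since \<open>(z - u) - (v - u) = z - v\<close>.\<close>
  moreover have "pairing (G v) (z - v) - pairing (G u) (z - v)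
      = bregman d G z u - bregman d G z v - bregman d G v u"
    by (simp add: bregman_def blinfun.diff_right)
  ultimately show ?thesis
    by (simp add: blinfun.diff_right)
qed

lemma mirror_prox_step:
  assumes "continuous_gradient_on Q d G" "convex Q"
    and first: "mirror_step Q d G (g u) M u v"
    and second: "mirror_step Q d G (g v) M u w"
    and test: "accept_test d G g M e u v w" and "x \<in> Q"
  shows "pairing (g v) (v - x) \<le> M * (bregman d G x u - bregman d G x w) + e * norm (v - w)"
proof -
  \<comment> \<open>The summands are bounded, in order, by the second prox step at \<open>x\<close>,
    the acceptance test, and the first prox step at \<open>w\<close>.\<close>
  have "pairing (g v) (v - x)
      = pairing (g v) (w - x) + pairing (g v - g u) (v - w) + pairing (g u) (v - w)"
    by (simp add: blinfun.diff_left blinfun.diff_right)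
  moreover have "pairing (g v) (w - x)
      \<le> M * (bregman d G x u - bregman d G x w - bregman d G w u)"
    by (rule mirror_step_three_point) fact+
  moreover have "pairing (g u) (v - w)
      \<le> M * (bregman d G w u - bregman d G w v - bregman d G v u)"
    by (rule mirror_step_three_point) (fact mirror_step_in[OF second] | fact)+
  ultimately show ?thesis
    using test by (simp add: accept_test_def algebra_simps)
qed

text \<open>A search can end only through \<open>accept\<close>, and each rejection doubles the
  trial parameter, which preserves its sign.\<close>

lemma mpai_search_accepted:
  assumes "mpai_search Q d G g u M e w v M' e'" "M > 0"
  shows "M' > 0 \<and> mirror_step Q d G (g u) M' u v \<and> mirror_step Q d G (g v) M' u w
    \<and> accept_test d G g M' e' u v w"
  using assms by induction auto

text \<open>The induction carries positivity: the accepted \<open>Ls (Suc k)\<close>, once halved,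
  is the starting value of the next search.\<close>

lemma mpai_run_step:
  assumes run: "mpai_run Q d G g N xs ys Ls ds" and "k < N"
  shows "Ls (Suc k) > 0
    \<and> mirror_step Q d G (g (xs k)) (Ls (Suc k)) (xs k) (ys (Suc k))
    \<and> mirror_step Q d G (g (ys (Suc k))) (Ls (Suc k)) (xs k) (xs (Suc k))
    \<and> accept_test d G g (Ls (Suc k)) (ds (Suc k)) (xs k) (ys (Suc k)) (xs (Suc k))"
  using \<open>k < N\<close>
proof (induction k)
  case 0
  then show ?case
    using run mpai_search_accepted[of Q d G g "xs 0" "Ls 0 / 2"] by (auto simp: mpai_run_def)
next
  case (Suc k)
  then show ?case
    using run mpai_search_accepted[of Q d G g "xs (Suc k)" "Ls (Suc k) / 2"]
    by (auto simp: mpai_run_def)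
qed

theorem theorem1:
  fixes Q :: "'a::real_normed_vector set"
    and d :: "'a \<Rightarrow> real"
    and G g :: "'a \<Rightarrow> 'a \<Rightarrow>\<^sub>L real"
    and L \<delta> :: real
    and N :: nat
    and xs ys :: "nat \<Rightarrow> 'a"
    and Ls ds :: "nat \<Rightarrow> real"
    and x :: 'a
  assumes "finite_dimensional_space TYPE('a)"
    and "Q \<noteq> {}" and "closed Q" and "convex Q"
    and "continuous_gradient_on Q d G"
    and "strongly_convex_on 1 Q d"
    and "argmin_on d Q 0"
    and "continuous_on Q g"
    and "L > 0" and "\<delta> > 0"
    and "\<And>x y z. x \<in> Q \<Longrightarrow> y \<in> Q \<Longrightarrow> z \<in> Q \<Longrightarrow>
           pairing (g y - g x) (y - z)
             \<le> L * bregman d G y x + L * bregman d G z y + \<delta> * norm (y - z)"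
    and "N \<ge> 1"
    and "mpai_run Q d G g N xs ys Ls ds"
    and "x \<in> Q"
  shows "(\<Sum>k=0..N-1. 1 / Ls (k + 1) * pairing (g (ys (k + 1))) (ys (k + 1) - x))
           \<le> bregman d G x (xs 0) - bregman d G x (xs N)
             + (\<Sum>k=0..N-1. ds (k + 1) / Ls (k + 1) * norm (ys (k + 1) - xs (k + 1)))"
proof -
  let ?V = "bregman d G x"
  let ?r = "\<lambda>k. ds (Suc k) / Ls (Suc k) * norm (ys (Suc k) - xs (Suc k))"
  have step: "1 / Ls (Suc k) * pairing (g (ys (Suc k))) (ys (Suc k) - x)
      \<le> ?V (xs k) - ?V (xs (Suc k)) + ?r k" if "k < N" for k
  proof -
    note k = mpai_run_step[OF \<open>mpai_run Q d G g N xs ys Ls ds\<close> that]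
    have "pairing (g (ys (Suc k))) (ys (Suc k) - x)
        \<le> Ls (Suc k) * (?V (xs k) - ?V (xs (Suc k))) + ds (Suc k) * norm (ys (Suc k) - xs (Suc k))"
      using mirror_prox_step[OF \<open>continuous_gradient_on Q d G\<close> \<open>convex Q\<close>] k \<open>x \<in> Q\<close> by blast
    then show ?thesis
      \<comment> \<open>Division by \<open>Ls (Suc k)\<close> keeps the inequality since it is
        positive.\<close>
      using k by (simp add: field_simps)
  qed
  have "(\<Sum>k<N. 1 / Ls (Suc k) * pairing (g (ys (Suc k))) (ys (Suc k) - x))
      \<le> (\<Sum>k<N. ?V (xs k) - ?V (xs (Suc k)) + ?r k)"
    by (intro sum_mono step) simp
  moreover have "(\<Sum>k<N. ?V (xs k) - ?V (xs (Suc k)) + ?r k) = ?V (xs 0) - ?V (xs N) + (\<Sum>k<N. ?r k)"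
    by (simp add: sum.distrib sum_lessThan_telescope'[where f = "\<lambda>k. ?V (xs k)"])
  \<comment> \<open>Subtraction on naturals truncates: for \<open>N = 0\<close> the left side would
    be \<open>{0}\<close>.\<close>
  moreover have "{0..N - 1} = {..<N}"
    using \<open>N \<ge> 1\<close> by auto
  ultimately show ?thesis
    by simp
qed

end
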